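(* Let $q\in[1,\infty)$. Consider the single DRCCP ($I=1$) under the type $q$-Wasserstein ambiguity set with affine mappings $a_1(x)=x$, $b_1(x)=b_1$ (a constant) and elliptical reference distribution $\tilde\zeta\sim\mathbb{P}_{\mathrm E}(\mu,\Sigma,\hat g)$, i.e. $$v_q^*=\min_{x\in\mathcal X}\{c^\top x:\mu^\top x+\eta_q^*\sqrt{x^\top\Sigma x}-b_1\le0\}.$$ Suppose that $\Sigma=\mu\mu^\top$, $\mu^\top x\ge0$ for every $x\in\mathcal X$, and $\eta_q^*\ge-1$. Then ALSO-X# is exact, i.e., $v_q^{A\#}=v_q^*$.
   Context: $\mathcal X\subseteq\mathbb{R}^n$, $c\in\mathbb{R}^n$, $b_1\in\mathbb{R}$, $\varepsilon\in(0,1)$, $\theta\ge0$, $(y)_+=\max\{y,0\}$. The norm defining the Wasserstein distance is the generalized Mahalanobis norm $\|y\|=\sqrt{y^\top\Sigma^\dagger y}$ ($\Sigma^\dagger$ the pseudo-inverse), whose dual norm is taken to be $\|x\|_*=\sqrt{x^\top\Sigma x}$. Elliptical distribution $\mathbb{P}_{\mathrm E}(\mu,\Sigma,\hat g)$: location $\mu\in\mathbb{R}^n$, positive semidefinite $\Sigma$, generating function $\hat g$, density $\bar k\,\hat g(\frac12(x-\mu)^\top\Sigma^{-1}(x-\mu))$, $\bar k>0$ a normalization constant; the standard univariate one has density $\bar k\hat g(z^2/2)$ and cumulative distribution function $\Phi$. For singular $\Sigma$: for every $x$, $x^\top\tilde\zeta$ has the law of $\mu^\top x+\sqrt{x^\top\Sigma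 x}\,Z$ with $Z\sim\mathbb{P}_{\mathrm E}(0,1,\hat g)$. The reference distribution $\mathbb{P}_\zeta$ of $\tilde\zeta$ is assumed sub-Gaussian. $$\eta_q^*=\min_\eta\Big\{\eta:\int_{\Phi^{-1}(1-\varepsilon)}^{\eta}(\eta-t)^q\,\bar k\hat g(t^2/2)\,dt\ge\theta^q,\ \eta\ge\Phi^{-1}(1-\varepsilon)\Big\}.$$ For $q>1$, $P_q(x,\lambda)=\|x\|_*^{\frac q{q-1}}\lambda^{-\frac1{q-1}}q^{-\frac q{q-1}}(q-1)$ (for $\lambda=0$: $0$ if $\|x\|_*=0$, else $+\infty$); for $q=1$, $P_1(x,\lambda)=0$ if $\|x\|_*\le\lambda$ and $+\infty$ otherwise. ALSO-X#: $v_q^{A\#}$ is the minimum (infimum) of all $t$ for which there is an optimal solution $(x^*,\lambda^*,\beta^* )$ of $\min\{\varepsilon\beta+\lambda\theta^q+\mathbb{E}_{\mathbb{P}_\zeta}[(x^\top\tilde\zeta-b_1+P_q(x,\lambda)-\beta)_+]:x\in\mathcal X,\ c^\top x\le t,\ \lambda\ge0,\ \beta\le0\}$ such that $x^*$ satisfies the worst-case chance constraint, i.e. $\mu^\top x^*+\eta_q^*\sqrt{(x^* )^\top\Sigma x^*}\le b_1$. Conventions: an infimum over the empty set is $+\infty$; the minimization problems are understood to attain their minima whenever feasible. *)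

theory Defs
  imports "HOL-Probability.Probability"
begin

definition psd_matrix :: "real^'n^'n \<Rightarrow> bool" where
  "psd_matrix \<Sigma> \<longleftrightarrow> transpose \<Sigma> = \<Sigma> \<and> (\<forall>x. 0 \<le> x \<bullet> (\<Sigma> *v x))"

(* Dual of the generalized Mahalanobis norm: \<parallel>x\<parallel>\<^sub>* = sqrt (x\<^sup>T \<Sigma> x). *)
definition dual_norm :: "real^'n^'n \<Rightarrow> real^'n \<Rightarrow> real" where
  "dual_norm \<Sigma> x = sqrt (x \<bullet> (\<Sigma> *v x))"

(* Exactly what is needed for z \<mapsto> g (z\<^sup>2 / 2) to be normalizable to a probability density;
   values of g at negative arguments are irrelevant. *)
definition generating_function :: "(real \<Rightarrow> real) \<Rightarrow> bool" where
  "generating_function g \<longleftrightarrow>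
     (\<forall>u\<ge>0. 0 \<le> g u) \<and> integrable lborel (\<lambda>z. g (z\<^sup>2 / 2)) \<and> 0 < (LINT z|lborel. g (z\<^sup>2 / 2))"

definition std_density :: "(real \<Rightarrow> real) \<Rightarrow> real \<Rightarrow> real" where
  "std_density g z = g (z\<^sup>2 / 2) / (LINT t|lborel. g (t\<^sup>2 / 2))"

definition std_elliptical :: "(real \<Rightarrow> real) \<Rightarrow> real measure" where
  "std_elliptical g = density lborel (\<lambda>z. ennreal (std_density g z))"

(* Generalized inverse of the distribution function, which is the ordinary inverse
   wherever the distribution function is continuous and strictly increasing. *)
definition std_quantile :: "(real \<Rightarrow> real) \<Rightarrow> real \<Rightarrow> real" where
  "std_quantile g p = Inf {z. p \<le> cdf (std_elliptical g) z}"

(* The normalization constant k of the multivariate density depends on \<Sigma> and on the dimension,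
   so it is in general different from that of std_density.  A singular \<Sigma> admits no density;
   the law is then described through its one-dimensional projections. *)
definition elliptical ::
  "real^'n \<Rightarrow> real^'n^'n \<Rightarrow> (real \<Rightarrow> real) \<Rightarrow> (real^'n) measure \<Rightarrow> bool" where
  "elliptical \<mu> \<Sigma> g P \<longleftrightarrow>
     prob_space P \<and> sets P = sets borel \<and> psd_matrix \<Sigma> \<and> generating_function g \<and>
     (if invertible \<Sigma>
      then \<exists>k>0. P = density lborel
             (\<lambda>z. ennreal (k * g (((z - \<mu>) \<bullet> (matrix_inv \<Sigma> *v (z - \<mu>))) / 2)))
      else \<forall>x. distr P borel (\<lambda>\<zeta>. x \<bullet> \<zeta>)
             = distr (std_elliptical g) borel (\<lambda>z. \<mu> \<bullet> x + sqrt (x \<bullet> (\<Sigma> *v x)) * z))"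

(* Sub-Gaussian tail bound; the property does not depend on the choice of the norm. *)
definition sub_gaussian :: "(real^'n) measure \<Rightarrow> bool" where
  "sub_gaussian P \<longleftrightarrow>
     (\<exists>C1>0. \<exists>C2>0. \<forall>t\<ge>0. measure P {\<zeta> \<in> space P. t \<le> norm \<zeta>} \<le> C1 * exp (- C2 * t\<^sup>2))"

definition eta_star :: "(real \<Rightarrow> real) \<Rightarrow> real \<Rightarrow> real \<Rightarrow> real \<Rightarrow> real" where
  "eta_star g \<epsilon> \<theta> q =
     Inf {\<eta>. \<theta> powr q \<le> (LINT t:{std_quantile g (1 - \<epsilon>)..\<eta>}|lborel. (\<eta> - t) powr q * std_density g t)
            \<and> std_quantile g (1 - \<epsilon>) \<le> \<eta>}"

definition penalty :: "real \<Rightarrow> real^'n^'n \<Rightarrow> real^'n \<Rightarrow> real \<Rightarrow> ereal" where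
  "penalty q \<Sigma> x l =
     (if q = 1 then (if dual_norm \<Sigma> x \<le> l then 0 else \<infinity>)
      else if l = 0 then (if dual_norm \<Sigma> x = 0 then 0 else \<infinity>)
      else ereal (dual_norm \<Sigma> x powr (q / (q - 1)) * l powr (- 1 / (q - 1))
                  * q powr (- q / (q - 1)) * (q - 1)))"

definition worst_case_cc ::
  "real^'n \<Rightarrow> real^'n^'n \<Rightarrow> (real \<Rightarrow> real) \<Rightarrow> real \<Rightarrow> real \<Rightarrow> real \<Rightarrow> real \<Rightarrow> real^'n \<Rightarrow> bool" where
  "worst_case_cc \<mu> \<Sigma> g \<epsilon> \<theta> q b x \<longleftrightarrow>
     \<mu> \<bullet> x + eta_star g \<epsilon> \<theta> q * sqrt (x \<bullet> (\<Sigma> *v x)) - b \<le> 0"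

definition drccp_value ::
  "(real^'n) set \<Rightarrow> real^'n \<Rightarrow> real^'n \<Rightarrow> real^'n^'n \<Rightarrow> (real \<Rightarrow> real) \<Rightarrow> real \<Rightarrow> real \<Rightarrow> real \<Rightarrow> real \<Rightarrow> ereal"
  where
  "drccp_value X c \<mu> \<Sigma> g \<epsilon> \<theta> q b = (INF x\<in>{x \<in> X. worst_case_cc \<mu> \<Sigma> g \<epsilon> \<theta> q b x}. ereal (c \<bullet> x))"

(* The objective is extended-real valued since the penalty may be infinite; the expectation of
   the nonnegative positive part is therefore a nonnegative integral. *)
definition alsox_objective ::
  "(real^'n) measure \<Rightarrow> real^'n^'n \<Rightarrow> real \<Rightarrow> real \<Rightarrow> real \<Rightarrow> real \<Rightarrow> (real^'n) \<times> real \<times> real \<Rightarrow> ereal" where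
  "alsox_objective P \<Sigma> \<epsilon> \<theta> q b = (\<lambda>(x, l, \<beta>).
     ereal (\<epsilon> * \<beta> + l * \<theta> powr q)
     + enn2ereal (\<integral>\<^sup>+ \<zeta>. e2ennreal (max 0 (ereal (x \<bullet> \<zeta> - b) + penalty q \<Sigma> x l - ereal \<beta>)) \<partial>P))"

definition alsox_feasible ::
  "(real^'n) set \<Rightarrow> real^'n \<Rightarrow> real \<Rightarrow> (real^'n) \<times> real \<times> real \<Rightarrow> bool" where
  "alsox_feasible X c t = (\<lambda>(x, l, \<beta>). x \<in> X \<and> c \<bullet> x \<le> t \<and> 0 \<le> l \<and> \<beta> \<le> 0)"

definition alsox_optimal ::
  "(real^'n) set \<Rightarrow> real^'n \<Rightarrow> (real^'n) measure \<Rightarrow> real^'n^'n \<Rightarrow> real \<Rightarrow> real \<Rightarrow> real \<Rightarrow> real \<Rightarrow> real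
    \<Rightarrow> (real^'n) \<times> real \<times> real \<Rightarrow> bool" where
  "alsox_optimal X c P \<Sigma> \<epsilon> \<theta> q b t =
     is_arg_min (alsox_objective P \<Sigma> \<epsilon> \<theta> q b) (alsox_feasible X c t)"

definition alsox_sharp_value ::
  "(real^'n) set \<Rightarrow> real^'n \<Rightarrow> (real^'n) measure \<Rightarrow> real^'n \<Rightarrow> real^'n^'n \<Rightarrow> (real \<Rightarrow> real)
    \<Rightarrow> real \<Rightarrow> real \<Rightarrow> real \<Rightarrow> real \<Rightarrow> ereal" where
  "alsox_sharp_value X c P \<mu> \<Sigma> g \<epsilon> \<theta> q b =
     (INF t\<in>{t. \<exists>x l \<beta>. alsox_optimal X c P \<Sigma> \<epsilon> \<theta> q b t (x, l, \<beta>) \<and> worst_case_cc \<mu> \<Sigma> g \<epsilon> \<theta> q b x}.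
        ereal t)"

end

theory Submission
  imports Defs
begin

text \<open>
  Write \<open>s = \<mu> \<bullet> x\<close>, which is nonnegative on the feasible set. For \<open>\<Sigma> = \<mu> \<mu>\<^sup>T\<close> the dual norm of \<open>x\<close>
  is \<open>s\<close> and \<open>x \<bullet> \<zeta>\<close> has the law of \<open>s (1 + Z)\<close>. Hence both the worst-case chance constraint
  \<open>(1 + \<eta>) s \<le> b\<close> and the lower-level objective depend on \<open>x\<close> only through \<open>s\<close>, and since
  \<open>1 + \<eta> \<ge> 0\<close> the constraint favours small \<open>s\<close>. The idea is that the lower level favours small
  \<open>s\<close> as well.

  Let \<open>x\<close> satisfy the worst-case constraint and let \<open>(x', l, \<beta>)\<close> be optimal at level \<open>t = c \<bullet> x\<close>.
  If \<open>\<mu> \<bullet> x' \<le> \<mu> \<bullet> x\<close>, then \<open>x'\<close> satisfies the constraint too. Otherwise \<open>\<mu> \<bullet> x = \<alpha> (\<mu> \<bullet> x')\<close> with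
  \<open>0 \<le> \<alpha> < 1\<close>, and the triple \<open>(x, \<alpha> l, \<alpha> (\<beta> + b) - b)\<close> is at least as good as \<open>(x', l, \<beta>)\<close>
  (lemma \<open>alsox_objective_shrink\<close>), so it is itself optimal. Either way \<open>t\<close> is admissible for the
  upper level, so the value of ALSO-X\<open>#\<close> is at most \<open>c \<bullet> x\<close>; the reverse inequality is immediate
  because every admissible \<open>t\<close> comes with a point that is feasible for the original program.

  The comparison rests on homogeneity: law and penalty scale by \<open>\<alpha>\<close> (lemmas
  \<open>rank_one_projection_scale\<close> and \<open>penalty_scale\<close>), so \<open>objective + \<epsilon> b\<close> is multiplied by \<open>\<alpha>\<close>.
  It remains to see that \<open>objective + \<epsilon> b \<ge> 0\<close>, that is, with \<open>\<gamma> = \<beta> + b\<close>,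
  \<open>\<epsilon> \<gamma> + l \<theta>\<^sup>q + E (x \<bullet> \<zeta> + p - \<gamma>)\<^sub>+ \<ge> 0\<close>, where \<open>p\<close> is the
  penalty, which may be taken finite. This is clear if \<open>\<gamma> \<ge> 0\<close>, and
  if \<open>\<gamma> < 0\<close> the expectation is at least \<open>\<mu> \<bullet> x + p - \<gamma> \<ge> - \<gamma> \<ge> - \<epsilon> \<gamma>\<close>
  by the symmetry of the law about \<open>\<mu> \<bullet> x\<close> (lemma \<open>elliptical_excess_ge_location\<close>).
\<close>

section \<open>Symmetry of elliptical distributions\<close>

lemma distr_density_invariant:
  assumes [measurable]: "f \<in> borel_measurable M" "T \<in> M \<rightarrow>\<^sub>M M"
    and "distr M M T = M" and "\<And>x. f (T x) = f x"
  shows "distr (density M f) M T = density M f"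
proof -
  have "density (distr M M T) f = distr (density M (\<lambda>x. f (T x))) M T"
    by (rule density_distr) simp_all
  then show ?thesis
    unfolding assms(3,4) by (rule sym)
qed

lemma std_elliptical_symmetric:
  assumes "generating_function g"
  shows "distr (std_elliptical g) borel uminus = std_elliptical g"
proof -
  have [measurable]: "(\<lambda>z. g (z\<^sup>2 / 2)) \<in> borel_measurable lborel"
    using assms unfolding generating_function_def by (blast dest: borel_measurable_integrable)
  have "distr (std_elliptical g) lborel uminus = std_elliptical g"
    unfolding std_elliptical_def
  proof (rule distr_density_invariant)
    show "(\<lambda>z. ennreal (std_density g z)) \<in> borel_measurable lborel"
      unfolding std_density_def by measurable
    have "distr lborel lborel uminus = distr lborel borel (uminus :: real \<Rightarrow> real)"
      by (rule distr_cong) simp_all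
    then show "distr lborel lborel uminus = (lborel :: real measure)"
      unfolding lborel_distr_uminus .
  qed (simp_all add: std_density_def)
  moreover have "distr (std_elliptical g) lborel uminus = distr (std_elliptical g) borel uminus"
    by (rule distr_cong) simp_all
  ultimately show ?thesis by (rule back_subst[of "\<lambda>M. M = std_elliptical g"])
qed

lemma elliptical_prob_space: "elliptical \<mu> \<Sigma> g P \<Longrightarrow> prob_space P"
  and elliptical_sets: "elliptical \<mu> \<Sigma> g P \<Longrightarrow> sets P = sets borel"
  unfolding elliptical_def by (elim conjE, assumption)+

lemma matrix_mul_matrix_inv:
  assumes "invertible A"
  shows "A ** matrix_inv A = mat 1"
  using someI_ex[OF assms[unfolded invertible_def]] by (simp add: matrix_inv_def)

lemma psd_matrix_inv_nonneg:
  fixes \<Sigma> :: "real^'n^'n"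
  assumes "psd_matrix \<Sigma>" "invertible \<Sigma>"
  shows "0 \<le> z \<bullet> (matrix_inv \<Sigma> *v z)"
proof -
  define w where "w = matrix_inv \<Sigma> *v z"
  have "\<Sigma> *v w = z"
    unfolding w_def using assms(2) by (metis matrix_mul_matrix_inv matrix_vector_mul_assoc matrix_vector_mul_lid)
  then have "z \<bullet> w = w \<bullet> (\<Sigma> *v w)"
    by (simp add: inner_commute)
  also have "\<dots> \<ge> 0"
    using assms(1) by (simp add: psd_matrix_def)
  finally show ?thesis by (simp add: w_def)
qed

text \<open>The density depends on \<open>z - \<mu>\<close> through a quadratic form, and reflection in \<open>\<mu>\<close> preserves
  Lebesgue measure.\<close>

lemma elliptical_reflection:
  assumes ell: "elliptical \<mu> \<Sigma> g P" and inv: "invertible \<Sigma>"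
  shows "distr P borel (\<lambda>\<zeta>. 2 *\<^sub>R \<mu> - \<zeta>) = P"
proof -
  obtain k where P: "P = density lborel
      (\<lambda>z. ennreal (k * g (((z - \<mu>) \<bullet> (matrix_inv \<Sigma> *v (z - \<mu>))) / 2)))"
    and psd: "psd_matrix \<Sigma>" and g: "generating_function g"
    using ell inv unfolding elliptical_def by auto
  define Q where "Q z = (z - \<mu>) \<bullet> (matrix_inv \<Sigma> *v (z - \<mu>))" for z
  have Q0: "0 \<le> Q z" for z
    unfolding Q_def by (rule psd_matrix_inv_nonneg[OF psd inv])
  have [measurable]: "Q \<in> borel_measurable borel"
    unfolding Q_def
    by (intro borel_measurable_continuous_onI continuous_intros
        linear_continuous_on_compose[OF _ matrix_vector_mul_linear])
  have "integrable lborel (\<lambda>z. g (z\<^sup>2 / 2))"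
    using g unfolding generating_function_def by blast
  then have h: "(\<lambda>z. g (z\<^sup>2 / 2)) \<in> borel_measurable borel"
    by (auto dest: borel_measurable_integrable)
  \<comment> \<open>Only \<open>z \<mapsto> g (z\<^sup>2 / 2)\<close> is known to be measurable, not \<open>g\<close> itself; positivity of \<open>Q\<close> lets the
      square root turn one into the other.\<close>
  have "(\<lambda>z. g (Q z / 2)) = (\<lambda>z. g ((sqrt (Q z))\<^sup>2 / 2))"
    using Q0 by simp
  also have "\<dots> \<in> borel_measurable borel"
    by (rule measurable_compose[OF _ h]) measurable
  finally have [measurable]: "(\<lambda>z. g (Q z / 2)) \<in> borel_measurable borel" .
  have "distr (density lborel (\<lambda>z. ennreal (k * g (Q z / 2)))) lborel (\<lambda>\<zeta>. 2 *\<^sub>R \<mu> - \<zeta>)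
      = density lborel (\<lambda>z. ennreal (k * g (Q z / 2)))"
  proof (rule distr_density_invariant)
    have "lborel = distr lborel borel (\<lambda>\<zeta>. 2 *\<^sub>R \<mu> - \<zeta>)"
      using lborel_affine[of "-1" "2 *\<^sub>R \<mu>"] by (simp add: density_1)
    also have "\<dots> = distr lborel lborel (\<lambda>\<zeta>. 2 *\<^sub>R \<mu> - \<zeta>)"
      by (rule distr_cong) simp_all
    finally show "distr lborel lborel (\<lambda>\<zeta>. 2 *\<^sub>R \<mu> - \<zeta>) = lborel" ..
    fix z
    have "2 *\<^sub>R \<mu> - z - \<mu> = - (z - \<mu>)"
      by (simp add: scaleR_2)
    then have "Q (2 *\<^sub>R \<mu> - z) = Q z"
      unfolding Q_def by (simp only: linear_neg[OF matrix_vector_mul_linear] inner_minus_left inner_minus_right minus_minus)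
    then show "ennreal (k * g (Q (2 *\<^sub>R \<mu> - z) / 2)) = ennreal (k * g (Q z / 2))"
      by simp
  qed simp_all
  then have "distr P lborel (\<lambda>\<zeta>. 2 *\<^sub>R \<mu> - \<zeta>) = P"
    unfolding P Q_def .
  moreover have "distr P lborel (\<lambda>\<zeta>. 2 *\<^sub>R \<mu> - \<zeta>) = distr P borel (\<lambda>\<zeta>. 2 *\<^sub>R \<mu> - \<zeta>)"
    by (rule distr_cong) simp_all
  ultimately show ?thesis by (rule back_subst[of "\<lambda>M. M = P"])
qed

lemma elliptical_projection_symmetric:
  fixes P :: "(real^'n) measure"
  assumes ell: "elliptical \<mu> \<Sigma> g P"
  shows "distr P borel (\<lambda>\<zeta>. 2 * (\<mu> \<bullet> x) - x \<bullet> \<zeta>) = distr P borel (\<lambda>\<zeta>. x \<bullet> \<zeta>)"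
proof -
  have [measurable_cong]: "sets P = sets borel"
    using ell by (rule elliptical_sets)
  show ?thesis
  proof (cases "invertible \<Sigma>")
    case True
    have "distr P borel (\<lambda>\<zeta>. x \<bullet> \<zeta>) = distr (distr P borel (\<lambda>\<zeta>. 2 *\<^sub>R \<mu> - \<zeta>)) borel (\<lambda>\<zeta>. x \<bullet> \<zeta>)"
      by (simp add: elliptical_reflection[OF ell True])
    also have "\<dots> = distr P borel (\<lambda>\<zeta>. 2 * (\<mu> \<bullet> x) - x \<bullet> \<zeta>)"
      by (subst distr_distr) (simp_all add: o_def inner_diff_right inner_commute)
    finally show ?thesis ..
  next
    case False
    define s where "s = sqrt (x \<bullet> (\<Sigma> *v x))"
    let ?E = "std_elliptical g"
    have [measurable_cong]: "sets ?E = sets borel"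
      by (simp add: std_elliptical_def)
    have law: "distr P borel (\<lambda>\<zeta>. x \<bullet> \<zeta>) = distr ?E borel (\<lambda>z. \<mu> \<bullet> x + s * z)"
      and g: "generating_function g"
      using ell False by (auto simp: elliptical_def s_def)
    have "distr P borel (\<lambda>\<zeta>. 2 * (\<mu> \<bullet> x) - x \<bullet> \<zeta>)
        = distr (distr P borel (\<lambda>\<zeta>. x \<bullet> \<zeta>)) borel (\<lambda>y. 2 * (\<mu> \<bullet> x) - y)"
      by (subst distr_distr) (simp_all add: o_def)
    also have "\<dots> = distr ?E borel (\<lambda>z. \<mu> \<bullet> x + s * (- z))"
      unfolding law by (subst distr_distr) (simp_all add: o_def algebra_simps)
    also have "\<dots> = distr (distr ?E borel uminus) borel (\<lambda>z. \<mu> \<bullet> x + s * z)"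
      by (subst distr_distr) (simp_all add: o_def)
    also have "\<dots> = distr P borel (\<lambda>\<zeta>. x \<bullet> \<zeta>)"
      unfolding std_elliptical_symmetric[OF g] law ..
    finally show ?thesis .
  qed
qed

text \<open>Jensen's inequality for the positive part, obtained from symmetry alone: averaging
  \<open>(Y - a)\<^sub>+ + (2 m - Y - a)\<^sub>+ \<ge> 2 (m - a)\<close> over a law symmetric about \<open>m\<close> gives twice the
  expected excess on the left.\<close>

lemma elliptical_excess_ge_location:
  fixes P :: "(real^'n) measure"
  assumes ell: "elliptical \<mu> \<Sigma> g P"
  shows "ennreal (\<mu> \<bullet> x - a) \<le> (\<integral>\<^sup>+ \<zeta>. ennreal (x \<bullet> \<zeta> - a) \<partial>P)"
proof -
  interpret prob_space P
    using ell by (rule elliptical_prob_space)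
  have [measurable_cong]: "sets P = sets borel"
    using ell by (rule elliptical_sets)
  let ?m = "\<mu> \<bullet> x"
  let ?I = "\<integral>\<^sup>+ \<zeta>. ennreal (x \<bullet> \<zeta> - a) \<partial>P"
  have "(\<integral>\<^sup>+ y. ennreal (y - a) \<partial>distr P borel (\<lambda>\<zeta>. 2 * ?m - x \<bullet> \<zeta>))
      = (\<integral>\<^sup>+ y. ennreal (y - a) \<partial>distr P borel (\<lambda>\<zeta>. x \<bullet> \<zeta>))"
    unfolding elliptical_projection_symmetric[OF ell] ..
  then have sym: "(\<integral>\<^sup>+ \<zeta>. ennreal (2 * ?m - x \<bullet> \<zeta> - a) \<partial>P) = ?I"
    by (simp add: nn_integral_distr)
  have "2 * ennreal (?m - a) = ennreal (2 * (?m - a))"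
    using ennreal_mult'[of 2 "?m - a"] by simp
  also have "\<dots> = (\<integral>\<^sup>+ \<zeta>. ennreal (2 * (?m - a)) \<partial>P)"
    by (simp only: nn_integral_const emeasure_space_1 mult_1_right)
  also have "\<dots> \<le> (\<integral>\<^sup>+ \<zeta>. ennreal (x \<bullet> \<zeta> - a) + ennreal (2 * ?m - x \<bullet> \<zeta> - a) \<partial>P)"
  proof (rule nn_integral_mono)
    fix \<zeta>
    have "ennreal (2 * (?m - a)) \<le> ennreal (max 0 (x \<bullet> \<zeta> - a) + max 0 (2 * ?m - x \<bullet> \<zeta> - a))"
      by (rule ennreal_leI) (simp add: max_def)
    also have "\<dots> = ennreal (x \<bullet> \<zeta> - a) + ennreal (2 * ?m - x \<bullet> \<zeta> - a)"
      by (subst ennreal_plus) (simp_all add: ennreal_max_0)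
    finally show "ennreal (2 * (?m - a)) \<le> ennreal (x \<bullet> \<zeta> - a) + ennreal (2 * ?m - x \<bullet> \<zeta> - a)" .
  qed
  also have "\<dots> = ?I + ?I"
    by (subst nn_integral_add) (simp_all add: sym)
  also have "\<dots> = 2 * ?I"
    by (simp add: mult_2)
  finally show ?thesis
    by (subst (asm) ennreal_mult_le_mult_iff) simp_all
qed

section \<open>Rank-one scale matrices and positive homogeneity\<close>

lemma outer_product_mult_vector:
  fixes \<mu> x :: "real^'n"
  shows "(\<chi> i j. \<mu> $ i * \<mu> $ j) *v x = (\<mu> \<bullet> x) *\<^sub>R \<mu>"
  by (simp add: vec_eq_iff matrix_vector_mult_def inner_vec_def sum_distrib_right
      sum_distrib_left mult_ac)

lemma dual_norm_rank_one:
  fixes \<mu> x :: "real^'n"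
  assumes "\<Sigma> = (\<chi> i j. \<mu> $ i * \<mu> $ j)"
  shows "dual_norm \<Sigma> x = \<bar>\<mu> \<bullet> x\<bar>"
  by (simp add: dual_norm_def assms outer_product_mult_vector inner_commute)

text \<open>For singular \<open>\<Sigma>\<close> this is read off from the law of the projections. If \<open>\<Sigma>\<close> is invertible,
  which happens in dimension one only, \<open>\<mu> \<bullet> x\<close> determines \<open>x\<close>, so that even \<open>y = \<alpha> x\<close>.\<close>

lemma rank_one_projection_scale:
  fixes P :: "(real^'n) measure"
  assumes ell: "elliptical \<mu> \<Sigma> g P" and \<Sigma>: "\<Sigma> = (\<chi> i j. \<mu> $ i * \<mu> $ j)"
    and \<alpha>: "0 \<le> \<alpha>" and loc: "\<mu> \<bullet> y = \<alpha> * (\<mu> \<bullet> x)"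
  shows "distr P borel (\<lambda>\<zeta>. y \<bullet> \<zeta>) = distr P borel (\<lambda>\<zeta>. \<alpha> * (x \<bullet> \<zeta>))"
proof (cases "invertible \<Sigma>")
  case True
  have "\<Sigma> *v y = \<Sigma> *v (\<alpha> *\<^sub>R x)"
    by (simp add: \<Sigma> outer_product_mult_vector loc)
  then have "y = \<alpha> *\<^sub>R x"
    using inj_matrix_vector_mult[OF True] by (simp add: inj_eq)
  then show ?thesis by simp
next
  case False
  have [measurable_cong]: "sets P = sets borel" "sets (std_elliptical g) = sets borel"
    using elliptical_sets[OF ell] by (simp_all add: std_elliptical_def)
  let ?E = "std_elliptical g"
  have law: "distr P borel (\<lambda>\<zeta>. v \<bullet> \<zeta>) = distr ?E borel (\<lambda>z. \<mu> \<bullet> v + \<bar>\<mu> \<bullet> v\<bar> * z)" for v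
    using ell False dual_norm_rank_one[OF \<Sigma>, of v] by (simp add: elliptical_def dual_norm_def)
  have "distr P borel (\<lambda>\<zeta>. \<alpha> * (x \<bullet> \<zeta>))
      = distr (distr P borel (\<lambda>\<zeta>. x \<bullet> \<zeta>)) borel (\<lambda>u. \<alpha> * u)"
    by (subst distr_distr) (simp_all add: o_def)
  also have "\<dots> = distr ?E borel (\<lambda>z. \<mu> \<bullet> y + \<bar>\<mu> \<bullet> y\<bar> * z)"
    unfolding law using \<alpha> by (subst distr_distr) (simp_all add: o_def loc abs_mult algebra_simps)
  finally show ?thesis by (simp add: law)
qed

lemma penalty_nonneg:
  assumes "1 \<le> q"
  shows "0 \<le> penalty q \<Sigma> x l"
  using assms by (simp add: penalty_def)

text \<open>For \<open>q > 1\<close> the exponents \<open>q / (q - 1)\<close> of the norm and \<open>- 1 / (q - 1)\<close> of \<open>l\<close> add up to one;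
  the conventions at \<open>l = 0\<close> are compatible with \<open>\<alpha> = 0\<close>.\<close>

lemma penalty_scale:
  assumes q: "1 \<le> q" and \<alpha>: "0 \<le> \<alpha>" and l: "0 \<le> l"
    and d: "0 \<le> dual_norm \<Sigma> x" "dual_norm \<Sigma> y = \<alpha> * dual_norm \<Sigma> x"
    and p: "penalty q \<Sigma> x l = ereal p"
  shows "penalty q \<Sigma> y (\<alpha> * l) = ereal (\<alpha> * p)"
proof (cases "q = 1")
  case True
  then show ?thesis
    using p d(2) \<alpha> by (auto simp: penalty_def mult_left_mono zero_ereal_def split: if_splits)
next
  case False
  show ?thesis
  proof (cases "\<alpha> = 0 \<or> l = 0")
    case True
    then show ?thesis
      using p d(2) False by (auto simp: penalty_def zero_ereal_def split: if_splits)
  next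
    case nz: False
    have "q / (q - 1) + - 1 / (q - 1) = 1"
      using False by (simp add: diff_divide_distrib[symmetric])
    then have "\<alpha> powr (q / (q - 1)) * \<alpha> powr (- 1 / (q - 1)) = \<alpha>"
      using nz \<alpha> by (simp add: powr_add[symmetric])
    then have "(\<alpha> * dual_norm \<Sigma> x) powr (q / (q - 1)) * (\<alpha> * l) powr (- 1 / (q - 1))
        = \<alpha> * (dual_norm \<Sigma> x powr (q / (q - 1)) * l powr (- 1 / (q - 1)))"
      using \<alpha> l d(1) by (simp add: powr_mult mult_ac)
    then show ?thesis
      using p d(2) False nz by (auto simp: penalty_def)
  qed
qed

section \<open>Monotonicity of the lower-level problem in the location\<close>

lemma alsox_objective_eq:
  assumes "penalty q \<Sigma> x l = ereal p"
  shows "alsox_objective P \<Sigma> \<epsilon> \<theta> q b (x, l, \<beta>)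
     = ereal (\<epsilon> * \<beta> + l * \<theta> powr q) + enn2ereal (\<integral>\<^sup>+ \<zeta>. ennreal (x \<bullet> \<zeta> + p - (\<beta> + b)) \<partial>P)"
proof -
  have "e2ennreal (max 0 (ereal (x \<bullet> \<zeta> - b) + ereal p - ereal \<beta>)) = ennreal (x \<bullet> \<zeta> + p - (\<beta> + b))"
    for \<zeta>
  proof -
    have "max 0 (ereal (x \<bullet> \<zeta> - b) + ereal p - ereal \<beta>) = ereal (max 0 (x \<bullet> \<zeta> + p - (\<beta> + b)))"
      by (simp add: zero_ereal_def max_def algebra_simps)
    then show ?thesis by (simp only: e2ennreal_ereal ennreal_max_0)
  qed
  then show ?thesis by (simp add: alsox_objective_def assms)
qed

lemma alsox_objective_infinite:
  assumes "prob_space P" "penalty q \<Sigma> x l = \<infinity>"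
  shows "alsox_objective P \<Sigma> \<epsilon> \<theta> q b (x, l, \<beta>) = \<infinity>"
  using prob_space.emeasure_space_1[OF assms(1)] by (simp add: alsox_objective_def assms(2) max_def)

text \<open>The new value of \<open>\<beta>\<close> is chosen so that \<open>\<beta> + b\<close>, the quantity subtracted from \<open>x \<bullet> \<zeta>\<close>, is
  multiplied by \<open>\<alpha>\<close> like the law, the penalty and \<open>l\<close>. So \<open>objective + \<epsilon> b\<close> is multiplied by
  \<open>\<alpha> \<le> 1\<close>, and it is nonnegative because the expected excess dominates \<open>\<mu> \<bullet> x + p - (\<beta> + b)\<close>
  for a finite penalty \<open>p\<close>; an infinite penalty makes the right-hand side infinite.\<close>

lemma alsox_objective_shrink:
  fixes P :: "(real^'n) measure"
  assumes ell: "elliptical \<mu> \<Sigma> g P" and \<Sigma>: "\<Sigma> = (\<chi> i j. \<mu> $ i * \<mu> $ j)"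
    and q: "1 \<le> q" and \<epsilon>: "0 < \<epsilon>" "\<epsilon> < 1" and l: "0 \<le> l"
    and x: "0 \<le> \<mu> \<bullet> x" and \<alpha>: "0 \<le> \<alpha>" "\<alpha> \<le> 1" and loc: "\<mu> \<bullet> y = \<alpha> * (\<mu> \<bullet> x)"
  shows "alsox_objective P \<Sigma> \<epsilon> \<theta> q b (y, \<alpha> * l, \<alpha> * (\<beta> + b) - b)
     \<le> alsox_objective P \<Sigma> \<epsilon> \<theta> q b (x, l, \<beta>)"
proof (cases "penalty q \<Sigma> x l")
  case PInf
  then show ?thesis
    by (simp add: alsox_objective_infinite elliptical_prob_space[OF ell])
next
  case MInf
  then show ?thesis
    using penalty_nonneg[OF q, of \<Sigma> x l] by simp
next
  case (real p)
  have [measurable_cong]: "sets P = sets borel"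
    using ell by (rule elliptical_sets)
  have p0: "0 \<le> p"
    using penalty_nonneg[OF q, of \<Sigma> x l] real by simp
  define \<gamma> where "\<gamma> = \<beta> + b"
  let ?I = "\<integral>\<^sup>+ \<zeta>. ennreal (x \<bullet> \<zeta> + p - \<gamma>) \<partial>P"
  have objx: "alsox_objective P \<Sigma> \<epsilon> \<theta> q b (x, l, \<beta>)
      = ereal (\<epsilon> * \<beta> + l * \<theta> powr q) + enn2ereal ?I"
    by (simp add: alsox_objective_eq[OF real] \<gamma>_def)
  have "dual_norm \<Sigma> y = \<alpha> * dual_norm \<Sigma> x"
    using \<alpha> by (simp add: dual_norm_rank_one[OF \<Sigma>] loc abs_mult)
  then have py: "penalty q \<Sigma> y (\<alpha> * l) = ereal (\<alpha> * p)"
    using penalty_scale[OF q \<alpha>(1) l _ _ real] by (simp add: dual_norm_rank_one[OF \<Sigma>])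
  have "(\<integral>\<^sup>+ \<zeta>. ennreal (y \<bullet> \<zeta> + \<alpha> * p - \<alpha> * \<gamma>) \<partial>P)
      = (\<integral>\<^sup>+ u. ennreal (u + \<alpha> * p - \<alpha> * \<gamma>) \<partial>distr P borel (\<lambda>\<zeta>. y \<bullet> \<zeta>))"
    by (simp add: nn_integral_distr)
  also have "\<dots> = (\<integral>\<^sup>+ \<zeta>. ennreal (\<alpha> * (x \<bullet> \<zeta>) + \<alpha> * p - \<alpha> * \<gamma>) \<partial>P)"
    unfolding rank_one_projection_scale[OF ell \<Sigma> \<alpha>(1) loc] by (simp add: nn_integral_distr)
  also have "\<dots> = (\<integral>\<^sup>+ \<zeta>. ennreal \<alpha> * ennreal (x \<bullet> \<zeta> + p - \<gamma>) \<partial>P)"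
    using \<alpha>(1) by (simp add: ennreal_mult'[symmetric] algebra_simps)
  also have "\<dots> = ennreal \<alpha> * ?I"
    by (rule nn_integral_cmult) measurable
  finally have Iy: "(\<integral>\<^sup>+ \<zeta>. ennreal (y \<bullet> \<zeta> + \<alpha> * p - \<alpha> * \<gamma>) \<partial>P) = ennreal \<alpha> * ?I" .
  have objy: "alsox_objective P \<Sigma> \<epsilon> \<theta> q b (y, \<alpha> * l, \<alpha> * (\<beta> + b) - b)
      = ereal (\<epsilon> * (\<alpha> * \<gamma> - b) + \<alpha> * l * \<theta> powr q) + enn2ereal (ennreal \<alpha> * ?I)"
    using Iy by (simp add: alsox_objective_eq[OF py] \<gamma>_def)
  show ?thesis
  proof (cases ?I)
    case top
    then show ?thesis by (simp add: objx)
  next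
    case (real r)
    have "ennreal (\<mu> \<bullet> x + p - \<gamma>) \<le> ?I"
      using elliptical_excess_ge_location[OF ell, of x "\<gamma> - p"] by (simp add: algebra_simps)
    then have r: "\<mu> \<bullet> x + p - \<gamma> \<le> r"
      using real by (simp add: ennreal_le_iff)
    \<comment> \<open>Up to the term in \<open>\<theta>\<close>, this says that the objective is at least \<open>- \<epsilon> b\<close>.\<close>
    have "0 \<le> \<epsilon> * \<gamma> + r"
    proof (cases "0 \<le> \<gamma>")
      case True
      then show ?thesis using real(1) \<epsilon> by simp
    next
      case False
      then have "\<gamma> \<le> \<epsilon> * \<gamma>"
        using \<epsilon> by (simp add: mult_le_cancel_right1)
      then show ?thesis using r x p0 by linarith
    qed
    moreover have "0 \<le> l * \<theta> powr q"
      using l by simp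
    ultimately have "0 \<le> (1 - \<alpha>) * (\<epsilon> * \<gamma> + l * \<theta> powr q + r)"
      using \<alpha> by (intro mult_nonneg_nonneg) simp_all
    then have "\<epsilon> * (\<alpha> * \<gamma> - b) + \<alpha> * l * \<theta> powr q + \<alpha> * r \<le> \<epsilon> * \<beta> + l * \<theta> powr q + r"
      by (simp add: \<gamma>_def algebra_simps)
    then show ?thesis
      unfolding objx objy real(2) using \<alpha>(1) real(1)
      by (simp add: ennreal_mult[symmetric] enn2ereal_ennreal)
  qed
qed

section \<open>Exactness\<close>

theorem corollary9:
  fixes X :: "(real^'n) set" and c \<mu> :: "real^'n" and \<Sigma> :: "real^'n^'n"
    and g :: "real \<Rightarrow> real" and P :: "(real^'n) measure"
    and b \<epsilon> \<theta> q :: real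
  assumes "1 \<le> q"
    and "0 < \<epsilon>" and "\<epsilon> < 1"
    and "0 \<le> \<theta>"
    and "elliptical \<mu> \<Sigma> g P"
    and "sub_gaussian P"
    and "\<Sigma> = (\<chi> i j. \<mu> $ i * \<mu> $ j)"
    and "\<forall>x\<in>X. 0 \<le> \<mu> \<bullet> x"
    and "- 1 \<le> eta_star g \<epsilon> \<theta> q"
    and lower_level_attained:
      "\<And>t. (\<exists>y. alsox_feasible X c t y) \<Longrightarrow> \<exists>y. alsox_optimal X c P \<Sigma> \<epsilon> \<theta> q b t y"
  shows "alsox_sharp_value X c P \<mu> \<Sigma> g \<epsilon> \<theta> q b = drccp_value X c \<mu> \<Sigma> g \<epsilon> \<theta> q b"
proof -
  note \<Sigma> = assms(7)
  let ?cc = "worst_case_cc \<mu> \<Sigma> g \<epsilon> \<theta> q b"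
  let ?f = "alsox_objective P \<Sigma> \<epsilon> \<theta> q b"
  define \<kappa> where "\<kappa> = 1 + eta_star g \<epsilon> \<theta> q"
  have \<kappa>: "0 \<le> \<kappa>"
    using assms(9) by (simp add: \<kappa>_def)
  have cc: "?cc x \<longleftrightarrow> \<kappa> * (\<mu> \<bullet> x) \<le> b" if "x \<in> X" for x
    using dual_norm_rank_one[OF \<Sigma>, of x] assms(8) that
    by (simp add: worst_case_cc_def dual_norm_def \<kappa>_def algebra_simps)
  have exact: "\<exists>x' l \<beta>. alsox_optimal X c P \<Sigma> \<epsilon> \<theta> q b (c \<bullet> x) (x', l, \<beta>) \<and> ?cc x'"
    if x: "x \<in> X" "?cc x" for x
  proof -
    have "alsox_feasible X c (c \<bullet> x) (x, 0, 0)"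
      using x by (simp add: alsox_feasible_def)
    then obtain x' l \<beta> where opt: "alsox_optimal X c P \<Sigma> \<epsilon> \<theta> q b (c \<bullet> x) (x', l, \<beta>)"
      using lower_level_attained by (metis prod_cases3)
    then have feas: "x' \<in> X" "0 \<le> l" "\<beta> \<le> 0"
      and min: "\<And>y. alsox_feasible X c (c \<bullet> x) y \<Longrightarrow> ?f (x', l, \<beta>) \<le> ?f y"
      by (auto simp: alsox_optimal_def is_arg_min_def alsox_feasible_def not_less)
    have x0: "0 \<le> \<mu> \<bullet> x" "0 \<le> \<mu> \<bullet> x'"
      using assms(8) x feas by auto
    show ?thesis
    proof (cases "\<mu> \<bullet> x' \<le> \<mu> \<bullet> x")
      case True
      then have "\<kappa> * (\<mu> \<bullet> x') \<le> \<kappa> * (\<mu> \<bullet> x)"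
        using \<kappa> by (rule mult_left_mono)
      then have "?cc x'"
        using x cc feas(1) by force
      then show ?thesis using opt by blast
    next
      case False
      define \<alpha> where "\<alpha> = (\<mu> \<bullet> x) / (\<mu> \<bullet> x')"
      have \<alpha>: "0 \<le> \<alpha>" "\<alpha> \<le> 1" and loc: "\<mu> \<bullet> x = \<alpha> * (\<mu> \<bullet> x')"
        using False x0 by (auto simp: \<alpha>_def)
      \<comment> \<open>The constraint forces \<open>b \<ge> 0\<close>, which keeps the new multiplier \<open>?\<beta>\<close> nonpositive.\<close>
      have "0 \<le> \<kappa> * (\<mu> \<bullet> x)"
        using \<kappa> x0 by simp
      then have b: "0 \<le> b"
        using x cc by force
      let ?\<beta> = "\<alpha> * (\<beta> + b) - b"
      have "\<alpha> * \<beta> \<le> 0" "\<alpha> * b \<le> b"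
        using \<alpha> b feas(3) by (simp_all add: mult_nonneg_nonpos mult_left_le_one_le)
      then have "alsox_feasible X c (c \<bullet> x) (x, \<alpha> * l, ?\<beta>)"
        using x \<alpha> feas by (simp add: alsox_feasible_def distrib_left)
      moreover have "?f (x, \<alpha> * l, ?\<beta>) \<le> ?f (x', l, \<beta>)"
        using assms(1-3) feas(2) x0(2) \<alpha> loc
        by (intro alsox_objective_shrink[OF assms(5) \<Sigma>])
      ultimately have "alsox_optimal X c P \<Sigma> \<epsilon> \<theta> q b (c \<bullet> x) (x, \<alpha> * l, ?\<beta>)"
        using min unfolding alsox_optimal_def is_arg_min_def
        by (meson leD order_trans)
      then show ?thesis using x by blast
    qed
  qed
  show ?thesis
    unfolding alsox_sharp_value_def drccp_value_def
  proof (rule antisym)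
    show "(INF t\<in>{t. \<exists>x l \<beta>. alsox_optimal X c P \<Sigma> \<epsilon> \<theta> q b t (x, l, \<beta>) \<and> ?cc x}. ereal t)
        \<le> (INF x\<in>{x \<in> X. ?cc x}. ereal (c \<bullet> x))"
      using exact by (intro INF_greatest INF_lower) simp
    show "(INF x\<in>{x \<in> X. ?cc x}. ereal (c \<bullet> x))
        \<le> (INF t\<in>{t. \<exists>x l \<beta>. alsox_optimal X c P \<Sigma> \<epsilon> \<theta> q b t (x, l, \<beta>) \<and> ?cc x}. ereal t)"
    proof (rule INF_greatest)
      fix t
      assume "t \<in> {t. \<exists>x l \<beta>. alsox_optimal X c P \<Sigma> \<epsilon> \<theta> q b t (x, l, \<beta>) \<and> ?cc x}"
      then obtain x where "x \<in> X" "?cc x" "c \<bullet> x \<le> t"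
        by (auto simp: alsox_optimal_def is_arg_min_def alsox_feasible_def)
      then show "(INF x\<in>{x \<in> X. ?cc x}. ereal (c \<bullet> x)) \<le> ereal t"
        by (intro INF_lower2[of x]) simp_all
    qed
  qed
qed

end
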